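(* Let $s\ge0$ be an integer, $h\in\mathbb C\setminus\{0\}$ and $q\in\mathbb C\setminus\{0\}$. For all nonnegative integers $n,m,k$, $$S_{s,h,q}[n+m,k]=\sum_{r=0}^n\sum_{j=0}^mh^{n-r}q^{r(j(1-s)+sm)}\genfrac{[}{]}{0pt}{}{n}{r}_{q^s}S_{s,h,q}[m,j]\,S_{s,h,q}[r,k-j]\prod_{i=0}^{n-r-1}[j(1-s)+sm+si]_q .$$ Moreover, $$B_{s,h,q}[n+m]=\sum_{r=0}^n\sum_{j=0}^mh^{n-r}q^{r(j(1-s)+sm)}\genfrac{[}{]}{0pt}{}{n}{r}_{q^s}S_{s,h,q}[m,j]\,B_{s,h,q}[r]\prod_{i=0}^{n-r-1}[j(1-s)+sm+si]_q .$$
   Context: For an integer $x$, $[x]_q=\frac{q^x-1}{q-1}$ if $q\ne1$ and $[x]_1=x$. $\genfrac{[}{]}{0pt}{}{n}{k}_p$ is the Gaussian ($p$-binomial) coefficient, understood as a polynomial in $p$ evaluated at the given value. The numbers $S_{s,h,q}[n,k]$ are the coefficients in $(VU)^n=\sum_{k=0}^nS_{s,h,q}[n,k]V^{sn-(s-1)k}U^k$, where $UV-qVU=hV^s$; equivalently they are determined by $S_{s,h,q}[n,k]=q^{s(n-1)-(s-1)(k-1)}S_{s,h,q}[n-1,k-1]+h[s(n-1)-(s-1)k]_q\,S_{s,h,q}[n-1,k]$ for $n,k\ge1$, with $S_{s,h,q}[n,0]=S_{s,h,q}[0,n]=\delta_{0,n}$; also $S_{s,h,q}[n,k]=0$ for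 $k<0$. The generalized $q$-Bell numbers are $B_{s,h,q}[n]=\sum_{k=0}^nS_{s,h,q}[n,k]$. Empty products equal $1$. *)

theory Defs
  imports Complex_Main "HOL-Computational_Algebra.Polynomial"
begin

definition q_num :: "complex \<Rightarrow> int \<Rightarrow> complex" where
  "q_num q x = (if q = 1 then of_int x else (q powi x - 1) / (q - 1))"

(* The Gaussian coefficient as a polynomial in p, namely the quotient of
   (1 - p^n)(1 - p^(n-1))...(1 - p^(n-k+1)) by (1 - p)(1 - p^2)...(1 - p^k).
   The division is exact (gauss_poly_exact), so evaluating the quotient is meaningful also
   when p is a root of unity.  For k > n the truncated subtraction yields a zero factor. *)
definition gauss_num :: "nat \<Rightarrow> nat \<Rightarrow> complex poly" where
  "gauss_num n k = (\<Prod>i<k. 1 - monom 1 (n - i))"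

definition gauss_den :: "nat \<Rightarrow> complex poly" where
  "gauss_den k = (\<Prod>i<k. 1 - monom 1 (Suc i))"

definition gauss_poly :: "nat \<Rightarrow> nat \<Rightarrow> complex poly" where
  "gauss_poly n k = gauss_num n k div gauss_den k"

definition gauss_binomial :: "complex \<Rightarrow> nat \<Rightarrow> nat \<Rightarrow> complex" where
  "gauss_binomial p n k = poly (gauss_poly n k) p"

(* The coefficients S_{s,h,q}[n,k], by their recurrence; the second index is an integer
   because values with negative k (which are 0) occur.  The relation with the expansion of
   (VU)^n is the lemma normal_ordering. *)
fun qS :: "nat \<Rightarrow> complex \<Rightarrow> complex \<Rightarrow> nat \<Rightarrow> int \<Rightarrow> complex" where
  "qS s h q 0 k = (if k = 0 then 1 else 0)"
| "qS s h q (Suc n) k =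
     (if k \<le> 0 then 0
      else q powi (int s * int n - (int s - 1) * (k - 1)) * qS s h q n (k - 1)
         + h * q_num q (int s * int n - (int s - 1) * k) * qS s h q n k)"

definition qBell :: "nat \<Rightarrow> complex \<Rightarrow> complex \<Rightarrow> nat \<Rightarrow> complex" where
  "qBell s h q n = (\<Sum>k\<le>n. qS s h q n (int k))"


lemma gauss_den_nonzero: "gauss_den k \<noteq> 0"
proof -
  have "1 - monom 1 (Suc i) \<noteq> (0 :: complex poly)" for i
  proof
    assume "1 - monom 1 (Suc i) = (0 :: complex poly)"
    then have "poly (1 - monom 1 (Suc i)) (0 :: complex) = 0" by simp
    then show False by (simp add: poly_monom)
  qed
  then show ?thesis by (simp add: gauss_den_def)
qed

lemma gauss_num_Suc_Suc:
  "gauss_num (Suc n) (Suc k) = (1 - monom 1 (Suc n)) * gauss_num n k"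
  unfolding gauss_num_def by (subst prod.lessThan_Suc_shift) simp

lemma gauss_num_eq_0: "n < k \<Longrightarrow> gauss_num n k = 0"
  unfolding gauss_num_def by (rule prod_zero) (auto intro!: bexI[of _ n] simp: one_pCons monom_0)

lemma gauss_den_dvd_num: "gauss_den k dvd gauss_num n k"
proof (induction n arbitrary: k)
  case 0
  show ?case
    by (cases k) (auto simp: gauss_num_eq_0, simp add: gauss_den_def)
next
  case (Suc n)
  show ?case
  proof (cases k)
    case 0
    then show ?thesis by (simp add: gauss_den_def)
  next
    case (Suc l)
    have "gauss_num (Suc n) (Suc l) =
        gauss_num n l * (1 - monom 1 (Suc l)) + monom 1 (Suc l) * gauss_num n (Suc l)"
    proof (cases "l \<le> n")
      case True
      have "gauss_num n (Suc l) = gauss_num n l * (1 - monom 1 (n - l))"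
        by (simp add: gauss_num_def)
      moreover have "monom 1 (Suc n) = monom 1 (Suc l) * (monom 1 (n - l) :: complex poly)"
        using True by (simp add: mult_monom)
      ultimately show ?thesis
        by (simp only: gauss_num_Suc_Suc) (simp add: algebra_simps)
    next
      case False
      then show ?thesis by (simp add: gauss_num_eq_0)
    qed
    moreover have "gauss_den (Suc l) dvd gauss_num n l * (1 - monom 1 (Suc l))"
      using Suc.IH[of l] by (simp add: gauss_den_def mult_dvd_mono)
    ultimately show ?thesis
      using Suc Suc.IH[of "Suc l"] by simp
  qed
qed

lemma gauss_poly_exact: "gauss_poly n k * gauss_den k = gauss_num n k"
  unfolding gauss_poly_def by (rule dvd_div_mult_self[OF gauss_den_dvd_num])

lemma qS_eq_0: "int n < k \<Longrightarrow> qS s h q n k = 0"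
  by (induction n arbitrary: k) auto

lemma q_num_Suc: "q \<noteq> 0 \<Longrightarrow> q_num q (int (Suc a)) = q * q_num q (int a) + 1"
  by (auto simp: q_num_def field_simps power_int_add)

(* c embeds the scalars into an arbitrary complex algebra.  The exponent s * (n - k) + k is
   s n - (s - 1) k, written so that it is visibly a natural number for k <= n. *)
lemma normal_ordering:
  fixes U V :: "'a :: ring_1" and c :: "complex \<Rightarrow> 'a"
  assumes q: "q \<noteq> 0"
    and c_add: "\<And>x y. c (x + y) = c x + c y"
    and c_mult: "\<And>x y. c (x * y) = c x * c y"
    and c_1: "c 1 = 1"
    and c_central: "\<And>x y. c x * y = y * c x"
    and comm: "U * V - c q * V * U = c h * V ^ s"
  shows "(V * U) ^ n =
    (\<Sum>k\<le>n. c (qS s h q n (int k)) * V ^ (s * (n - k) + k) * U ^ k)"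
proof -
  have c_0: "c 0 = 0" using c_add[of 0 0] by simp
  have UV: "U * V = c q * V * U + c h * V ^ s"
    using comm by (simp add: algebra_simps)
  have VU: "V * U * V ^ a = c (q ^ a) * V ^ Suc a * U + c (h * q_num q (int a)) * V ^ (a + s)"
    for a
  proof (induction a)
    case 0
    show ?case by (simp add: c_1 c_0 q_num_def)
  next
    case (Suc a)
    have "V * U * V ^ Suc a = V * (U * V) * V ^ a" by (simp add: mult.assoc)
    also have "\<dots> = V * (c q * V * U) * V ^ a + V * (c h * V ^ s) * V ^ a"
      by (simp add: UV algebra_simps)
    also have "V * (c q * V * U) * V ^ a = c q * V * (V * U * V ^ a)"
      using c_central[of q V] by (metis mult.assoc)
    also have "V * (c h * V ^ s) * V ^ a = c h * V ^ (Suc a + s)"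
    proof -
      have "V * (c h * V ^ s) * V ^ a = c h * (V * V ^ s * V ^ a)"
        using c_central[of h V] by (metis mult.assoc)
      also have "V * V ^ s * V ^ a = V ^ (Suc a + s)"
        by (simp flip: power_Suc power_add add: add.commute)
      finally show ?thesis .
    qed
    also have "c q * V * (V * U * V ^ a) =
        c (q ^ Suc a) * V ^ Suc (Suc a) * U + c (h * q * q_num q (int a)) * V ^ (Suc a + s)"
    proof -
      have "c q * V * (c x * Y) = c (q * x) * (V * Y)" for x Y
        using c_central[of x V] c_mult by (metis mult.assoc)
      then show ?thesis
        unfolding Suc.IH by (simp add: distrib_left mult.assoc) (simp add: mult.left_commute)
    qed
    finally show ?case
      by (simp add: q_num_Suc[OF q, simplified] c_add algebra_simps)
  qed
  define T where "T n k = c (qS s h q n (int k)) * V ^ (s * (n - k) + k) * U ^ k" for n k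
  define A where "A n k = c (q ^ (s * (n - k) + k) * qS s h q n (int k))
      * V ^ Suc (s * (n - k) + k) * U ^ Suc k" for n k
  define B where "B n k = c (h * q_num q (int (s * (n - k) + k)) * qS s h q n (int k))
      * V ^ (s * (n - k) + k + s) * U ^ k" for n k
  have step: "V * U * T n k = A n k + B n k" for n k
  proof -
    let ?a = "s * (n - k) + k" and ?x = "qS s h q n (int k)"
    have "V * U * T n k = c ?x * (V * U * V ^ ?a) * U ^ k"
      unfolding T_def using c_central[of ?x "V * U"] by (metis mult.assoc)
    also have "\<dots> = A n k + B n k"
    proof -
      have "c x * c y = c (y * x)" for x y
        by (simp add: c_mult[symmetric] mult.commute)
      then have *: "c x * (c y * Y) = c (y * x) * Y" for x y Y
        by (simp add: mult.assoc[symmetric])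
      show ?thesis
        unfolding VU A_def B_def
        by (simp only: distrib_left distrib_right mult.assoc[where 'a = 'a] * power_Suc)
    qed
    finally show ?thesis .
  qed
  have T_Suc: "T (Suc n) (Suc k) = A n k + (if k < n then B n (Suc k) else 0)"
    if "k \<le> n" for n k
  proof -
    have e1: "int s * int n - (int s - 1) * int k = int (s * (n - k) + k)"
      by (simp only: of_nat_add of_nat_mult of_nat_diff[OF that]) (simp add: algebra_simps)
    show ?thesis
    proof (cases "k < n")
      case True
      then have e2: "int s * int n - (int s - 1) * int (Suc k) = int (s * (n - Suc k) + Suc k)"
        by (simp only: of_nat_add of_nat_mult of_nat_diff[OF Suc_leI]) (simp add: algebra_simps)
      have e3: "s * (n - k) + Suc k = s * (n - Suc k) + Suc k + s"
        using True by (simp add: Suc_diff_Suc[symmetric])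
      then have e4: "Suc (s * (n - k) + k) = s * (n - Suc k) + Suc k + s"
        by simp
      have "qS s h q (Suc n) (int (Suc k)) =
          q ^ (s * (n - k) + k) * qS s h q n (int k)
          + h * q_num q (int (s * (n - Suc k) + Suc k)) * qS s h q n (int (Suc k))"
        by (simp only: qS.simps e2) (simp add: e1 flip: power_int_of_nat)
      then show ?thesis
        unfolding T_def A_def B_def
        using True by (simp only: c_add distrib_right diff_Suc_Suc e3 e4 if_True)
    next
      case False
      with that have [simp]: "k = n" by simp
      have "qS s h q (Suc n) (int (Suc n)) = q ^ n * qS s h q n (int n)"
        using e1 qS_eq_0[of n "int n + 1" s h q] by (simp add: add.commute)
      then show ?thesis
        unfolding T_def A_def by simp
    qed
  qed
  have B_0: "B n 0 = 0" for n
    by (cases n) (simp_all add: B_def c_0 q_num_def)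
  have T_Suc_0: "T (Suc n) 0 = 0" for n
    by (simp add: T_def c_0)
  have "(V * U) ^ n = (\<Sum>k\<le>n. T n k)"
  proof (induction n)
    case 0
    show ?case by (simp add: T_def c_1)
  next
    case (Suc n)
    have "(V * U) ^ Suc n = (\<Sum>k\<le>n. A n k) + (\<Sum>k\<le>n. B n k)"
      by (simp add: Suc.IH sum_distrib_left step sum.distrib)
    also have "(\<Sum>k\<le>n. B n k) = (\<Sum>k<n. B n (Suc k))"
      by (cases n) (simp_all add: B_0 sum.atMost_Suc_shift lessThan_Suc_atMost del: sum.atMost_Suc)
    also have "\<dots> = (\<Sum>k\<le>n. if k < n then B n (Suc k) else 0)"
      by (rule sum.mono_neutral_cong_left) auto
    also have "(\<Sum>k\<le>n. A n k) + \<dots> = (\<Sum>k\<le>n. T (Suc n) (Suc k))"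
      by (simp add: T_Suc flip: sum.distrib)
    also have "\<dots> = (\<Sum>k\<le>Suc n. T (Suc n) k)"
      by (simp add: sum.atMost_Suc_shift T_Suc_0 del: sum.atMost_Suc)
    finally show ?case .
  qed
  then show ?thesis by (simp add: T_def)
qed

end

(* The sum over j conditions on the normal ordering of the last m factors V U in (V U)^(n + m):
   multiplying V^a U^j, where a = s m - (s - 1) j, from the left by (V U)^n gives a
   q-Stirling array whose weights are shifted by a.  The identity
   [x + y]_q = [x]_q + q^x [y]_q splits the shifted recurrence into the unshifted one and a
   multiplication by [a + s (n - r)]_q, so the shifted array is a combination of the rows
   qS r, and the coefficients of this combination satisfy a Gaussian Pascal rule in q^s. *)
theory Submission
  imports Defs
begin

lemma q_num_0 [simp]: "q_num q 0 = 0"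
  by (simp add: q_num_def)

lemma q_num_add: "q \<noteq> 0 \<Longrightarrow> q_num q (x + y) = q_num q x + q powi x * q_num q y"
  by (simp add: q_num_def power_int_add diff_divide_distrib right_diff_distrib)

lemma gauss_binomial_0 [simp]: "gauss_binomial p n 0 = 1"
  by (simp add: gauss_binomial_def gauss_poly_def gauss_num_def gauss_den_def)

lemma gauss_binomial_eq_0: "n < k \<Longrightarrow> gauss_binomial p n k = 0"
  by (simp add: gauss_binomial_def gauss_poly_def gauss_num_eq_0)

text \<open>With x the variable, 1 - x^(n+1) = x^(n-k) (1 - x^(k+1)) + (1 - x^(n-k)). The
  denominator is cancelled as a nonzero polynomial, so the rule survives evaluation at roots of
  unity.\<close>

lemma gauss_poly_Suc_Suc:
  assumes "k \<le> n"
  shows "gauss_poly (Suc n) (Suc k) = monom 1 (n - k) * gauss_poly n k + gauss_poly n (Suc k)"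
proof -
  let ?x = "\<lambda>i. monom 1 i :: complex poly"
  have den: "gauss_den (Suc k) = gauss_den k * (1 - ?x (Suc k))"
    by (simp add: gauss_den_def)
  have num: "gauss_num n (Suc k) = gauss_num n k * (1 - ?x (n - k))"
    by (simp add: gauss_num_def)
  have x: "?x (Suc n) = ?x (n - k) * ?x (Suc k)"
    using assms by (simp add: mult_monom)
  have "gauss_poly (Suc n) (Suc k) * gauss_den (Suc k) = (1 - ?x (Suc n)) * gauss_num n k"
    by (simp only: gauss_poly_exact gauss_num_Suc_Suc)
  also have "\<dots> = ?x (n - k) * gauss_num n k * (1 - ?x (Suc k)) + gauss_num n (Suc k)"
    by (simp only: num x) (simp add: algebra_simps)
  also have "\<dots> = (?x (n - k) * gauss_poly n k + gauss_poly n (Suc k)) * gauss_den (Suc k)"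
    by (simp only: distrib_right gauss_poly_exact) (simp only: den gauss_poly_exact[symmetric] ac_simps)
  finally show ?thesis
    using gauss_den_nonzero by simp
qed

lemma gauss_binomial_Suc_Suc:
  "k \<le> n \<Longrightarrow> gauss_binomial p (Suc n) (Suc k) =
    p ^ (n - k) * gauss_binomial p n k + gauss_binomial p n (Suc k)"
  by (simp add: gauss_binomial_def gauss_poly_Suc_Suc poly_monom)

lemma qS_neg: "k < 0 \<Longrightarrow> qS s h q n k = 0"
  by (cases n) auto

text \<open>Removes the case split of the definition, since the recurrence is later used at
  arbitrary indices k - j. At k = 0 the last term vanishes: for n = 0 its weight is [0]_q, for n > 0
  the entry itself is 0.\<close>

lemma qS_Suc:
  "qS s h q (Suc n) k =
    q powi (int s * int n - (int s - 1) * (k - 1)) * qS s h q n (k - 1)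
      + h * q_num q (int s * int n - (int s - 1) * k) * qS s h q n k"
proof (cases "k \<le> 0")
  case True
  then have "k < 0 \<or> k = 0 \<and> n = 0 \<or> k = 0 \<and> n > 0" by auto
  then show ?thesis
    by (cases n) (auto simp: qS_neg)
qed simp

text \<open>Here \<open>a\<close> is the exponent in V^a U^j. It is an integer so that j (1 - s) + s
  m involves no truncated subtraction.\<close>

definition shift_coeff :: "nat \<Rightarrow> complex \<Rightarrow> complex \<Rightarrow> int \<Rightarrow> nat \<Rightarrow> nat \<Rightarrow> complex" where
  "shift_coeff s h q a n r = h ^ (n - r) * q powi (int r * a) * gauss_binomial (q ^ s) n r
     * (\<Prod>i<n - r. q_num q (a + int s * int i))"

lemma shift_coeff_eq_0: "n < r \<Longrightarrow> shift_coeff s h q a n r = 0"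
  by (simp add: shift_coeff_def gauss_binomial_eq_0)

lemma shift_coeff_Suc_0:
  "shift_coeff s h q a (Suc n) 0 = h * q_num q (a + int s * int n) * shift_coeff s h q a n 0"
  by (simp add: shift_coeff_def)

text \<open>This is the Pascal rule for base q^s times a common factor. In the first term q^(a + s
  (n - r)) raises q^(r a) to q^((r+1) a) and leaves the Pascal weight (q^s)^(n - r); in the second,
  [a + s (n - r - 1)]_q becomes the last factor of the product.\<close>

lemma shift_coeff_Suc_Suc:
  assumes "q \<noteq> 0" and "r \<le> n"
  shows "shift_coeff s h q a (Suc n) (Suc r) =
    q powi (a + int s * (int n - int r)) * shift_coeff s h q a n r
      + h * q_num q (a + int s * (int n - int (Suc r))) * shift_coeff s h q a n (Suc r)"
proof -
  let ?P = "\<lambda>t. \<Prod>i<t. q_num q (a + int s * int i)"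
  have pow: "q powi (a + int s * (int n - int r)) * q powi (int r * a)
      = q powi (int (Suc r) * a) * (q ^ s) ^ (n - r)"
  proof -
    have "(q ^ s) ^ (n - r) = q powi (int s * (int n - int r))"
      using assms(2) by (metis of_nat_diff of_nat_mult power_int_of_nat power_mult)
    then show ?thesis
      using assms(1) by (simp add: algebra_simps flip: power_int_add)
  qed
  have second: "h * q_num q (a + int s * (int n - int (Suc r))) * shift_coeff s h q a n (Suc r)
      = h ^ (n - r) * q powi (int (Suc r) * a) * gauss_binomial (q ^ s) n (Suc r) * ?P (n - r)"
  proof (cases "r < n")
    case True
    then obtain t where t: "n = Suc (r + t)" by (auto dest: less_imp_Suc_add)
    then show ?thesis
      by (simp add: shift_coeff_def ac_simps)
  next
    \<comment> \<open>Now r = n, and the truncated \<open>n - Suc r\<close> is 0 while the argument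
      of \<open>q_num\<close> uses -1. This is harmless because both Gaussian coefficients
      vanish.\<close>
    case False
    then show ?thesis
      by (simp add: shift_coeff_eq_0 gauss_binomial_eq_0)
  qed
  have first: "q powi (a + int s * (int n - int r)) * shift_coeff s h q a n r
      = h ^ (n - r) * (q powi (a + int s * (int n - int r)) * q powi (int r * a))
        * gauss_binomial (q ^ s) n r * ?P (n - r)"
    by (simp only: shift_coeff_def ac_simps)
  show ?thesis
    unfolding first second pow
    by (simp only: shift_coeff_def diff_Suc_Suc gauss_binomial_Suc_Suc[OF assms(2)]
        distrib_left distrib_right ac_simps)
qed

text \<open>The array with shifted weights, given directly by its expansion in the rows of
  \<open>qS\<close>; its recurrence is then a result. For a = 0 the factor [0]_q kills all terms
  with r < n and row n of \<open>qS\<close> remains.\<close>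

definition shifted_qS :: "nat \<Rightarrow> complex \<Rightarrow> complex \<Rightarrow> int \<Rightarrow> nat \<Rightarrow> int \<Rightarrow> complex" where
  "shifted_qS s h q a n l = (\<Sum>r\<le>n. shift_coeff s h q a n r * qS s h q r l)"

lemma shifted_qS_0: "shifted_qS s h q a 0 l = (if l = 0 then 1 else 0)"
  by (simp add: shifted_qS_def shift_coeff_def)

lemma shifted_qS_Suc:
  assumes "q \<noteq> 0"
  shows "shifted_qS s h q a (Suc n) l =
    q powi (a + int s * int n - (int s - 1) * (l - 1)) * shifted_qS s h q a n (l - 1)
      + h * q_num q (a + int s * int n - (int s - 1) * l) * shifted_qS s h q a n l"
proof -
  let ?c = "shift_coeff s h q a" and ?S = "qS s h q"
  define x where "x r = a + int s * (int n - int r)" for r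
  \<comment> \<open>Each shifted weight has argument x r plus the argument of the unshifted weight
    in row r. Splitting off x r, which does not depend on l, leaves exactly the recurrence for row r
    + 1.\<close>
  have row: "q powi (a + int s * int n - (int s - 1) * (l - 1)) * ?S r (l - 1)
      + h * q_num q (a + int s * int n - (int s - 1) * l) * ?S r l
      = q powi x r * ?S (Suc r) l + h * q_num q (x r) * ?S r l" for r
  proof -
    have e: "a + int s * int n - (int s - 1) * (l - 1)
        = x r + (int s * int r - (int s - 1) * (l - 1))"
      and e': "a + int s * int n - (int s - 1) * l = x r + (int s * int r - (int s - 1) * l)"
      by (simp_all add: x_def algebra_simps)
    have pow: "q powi (x r + y) = q powi x r * q powi y" for y
      using assms by (simp add: power_int_add)
    show ?thesis
      unfolding e e' qS_Suc q_num_add[OF assms] pow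
      by (simp only: distrib_left distrib_right ac_simps)
  qed
  have "shifted_qS s h q a (Suc n) l
      = ?c (Suc n) 0 * ?S 0 l + (\<Sum>r\<le>n. ?c (Suc n) (Suc r) * ?S (Suc r) l)"
    by (simp only: shifted_qS_def sum.atMost_Suc_shift)
  also have "\<dots> = h * q_num q (x 0) * ?c n 0 * ?S 0 l
      + (\<Sum>r\<le>n. h * q_num q (x (Suc r)) * ?c n (Suc r) * ?S (Suc r) l)
      + (\<Sum>r\<le>n. q powi x r * ?c n r * ?S (Suc r) l)"
    using assms
    by (simp add: shift_coeff_Suc_0 shift_coeff_Suc_Suc x_def distrib_right sum.distrib
        del: qS.simps)
  \<comment> \<open>The separate r = 0 term completes the sum over successors. The extra top term r
    = n + 1 then drops out, as its coefficient in row n is 0.\<close>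
  also have "h * q_num q (x 0) * ?c n 0 * ?S 0 l
      + (\<Sum>r\<le>n. h * q_num q (x (Suc r)) * ?c n (Suc r) * ?S (Suc r) l)
      = (\<Sum>r\<le>Suc n. h * q_num q (x r) * ?c n r * ?S r l)"
    by (simp only: sum.atMost_Suc_shift)
  also have "\<dots> = (\<Sum>r\<le>n. h * q_num q (x r) * ?c n r * ?S r l)"
    by (simp add: shift_coeff_eq_0)
  also have "\<dots> + (\<Sum>r\<le>n. q powi x r * ?c n r * ?S (Suc r) l)
      = (\<Sum>r\<le>n. ?c n r * (q powi x r * ?S (Suc r) l + h * q_num q (x r) * ?S r l))"
    by (simp add: algebra_simps del: qS.simps flip: sum.distrib)
  also have "\<dots> = q powi (a + int s * int n - (int s - 1) * (l - 1)) * shifted_qS s h q a n (l - 1)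
      + h * q_num q (a + int s * int n - (int s - 1) * l) * shifted_qS s h q a n l"
    unfolding row[symmetric] shifted_qS_def
    by (simp only: sum_distrib_left distrib_left sum.distrib ac_simps)
  finally show ?thesis .
qed

text \<open>Both sides satisfy the same recurrence in n. For n = 0 the shifted array is a Kronecker
  delta, which selects j = k.\<close>

lemma qS_add:
  assumes "q \<noteq> 0"
  shows "qS s h q (n + m) k =
    (\<Sum>j\<le>m. qS s h q m (int j)
      * shifted_qS s h q (int j * (1 - int s) + int s * int m) n (k - int j))"
proof (induction n arbitrary: k)
  case 0
  show ?case
  proof (cases "0 \<le> k \<and> k \<le> int m")
    case True
    then obtain i where i: "k = int i" "i \<le> m"
      by (metis nonneg_int_cases of_nat_le_iff)
    then show ?thesis
      by (simp add: shifted_qS_0 if_distrib[of "\<lambda>x. _ * x"] cong: if_cong)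
  next
    case False
    then have "qS s h q m k = 0"
      by (auto simp: qS_neg qS_eq_0)
    moreover have "k \<noteq> int j" if "j \<le> m" for j
      using False that by auto
    ultimately show ?thesis
      by (auto simp: shifted_qS_0 intro!: sum.neutral[symmetric])
  qed
next
  case (Suc n)
  define a where "a j = int j * (1 - int s) + int s * int m" for j
  \<comment> \<open>This is what the choice of a achieves: the weights at column l - j no longer
    depend on j, so they can be pulled out of the sum over j.\<close>
  have e: "a j + int s * int n - (int s - 1) * (l - int j)
      = int s * int (n + m) - (int s - 1) * l" for j l
    by (simp add: a_def algebra_simps)
  have d: "k - int j - 1 = k - 1 - int j" for j
    by simp
  show ?case
    unfolding add_Suc qS_Suc Suc.IH a_def[symmetric] shifted_qS_Suc[OF assms] d e
    by (simp only: sum_distrib_left distrib_left sum.distrib ac_simps)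
qed

lemma qS_add_expanded:
  assumes "q \<noteq> 0"
  shows "qS s h q (n + m) k =
    (\<Sum>r\<le>n. \<Sum>j\<le>m. shift_coeff s h q (int j * (1 - int s) + int s * int m) n r
      * qS s h q m (int j) * qS s h q r (k - int j))"
  unfolding qS_add[OF assms] shifted_qS_def
  by (subst sum.swap) (simp only: sum_distrib_left ac_simps)

text \<open>The nonzero entries of row r lie in columns 0 to r, so the bound on N ensures that the
  sum catches all of them after the shift by j.\<close>

lemma sum_qS_shift:
  assumes "r + j \<le> N"
  shows "(\<Sum>k\<le>N. qS s h q r (int k - int j)) = qBell s h q r"
proof -
  have "(\<Sum>k\<le>N. qS s h q r (int k - int j)) = (\<Sum>k\<in>{j..r + j}. qS s h q r (int k - int j))"
    using assms by (intro sum.mono_neutral_right) (auto simp: not_le qS_neg qS_eq_0)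
  also have "\<dots> = (\<Sum>k\<in>{0..r}. qS s h q r (int k))"
    using sum.shift_bounds_cl_nat_ivl[of "\<lambda>k. qS s h q r (int k - int j)" 0 j r] by simp
  finally show ?thesis
    by (simp add: qBell_def atLeast0AtMost)
qed

lemma qBell_add:
  assumes "q \<noteq> 0"
  shows "qBell s h q (n + m) =
    (\<Sum>r\<le>n. \<Sum>j\<le>m. shift_coeff s h q (int j * (1 - int s) + int s * int m) n r
      * qS s h q m (int j) * qBell s h q r)"
proof -
  let ?C = "\<lambda>r j. shift_coeff s h q (int j * (1 - int s) + int s * int m) n r * qS s h q m (int j)"
  have "qBell s h q (n + m) =
      (\<Sum>k\<le>n + m. \<Sum>r\<le>n. \<Sum>j\<le>m. ?C r j * qS s h q r (int k - int j))"
    by (simp only: qBell_def qS_add_expanded[OF assms])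
  also have "\<dots> = (\<Sum>r\<le>n. \<Sum>j\<le>m. \<Sum>k\<le>n + m. ?C r j * qS s h q r (int k - int j))"
    by (subst sum.swap) (intro sum.cong refl sum.swap)
  \<comment> \<open>Only the last factor depends on k, and r + j \<le> n + m makes the range of k
    long enough for the whole Bell sum.\<close>
  also have "\<dots> = (\<Sum>r\<le>n. \<Sum>j\<le>m. ?C r j * qBell s h q r)"
    by (intro sum.cong refl) (simp add: sum_qS_shift flip: sum_distrib_left)
  finally show ?thesis .
qed

theorem theorem18:
  fixes s :: nat and h q :: complex
  assumes "h \<noteq> 0" and "q \<noteq> 0"
  shows "(\<forall>n m k :: nat.
      qS s h q (n + m) (int k) =
        (\<Sum>r\<le>n. \<Sum>j\<le>m.
           h ^ (n - r) * q powi (int r * (int j * (1 - int s) + int s * int m))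
           * gauss_binomial (q ^ s) n r
           * qS s h q m (int j) * qS s h q r (int k - int j)
           * (\<Prod>i<n - r. q_num q (int j * (1 - int s) + int s * int m + int s * int i))))
    \<and> (\<forall>n m :: nat.
      qBell s h q (n + m) =
        (\<Sum>r\<le>n. \<Sum>j\<le>m.
           h ^ (n - r) * q powi (int r * (int j * (1 - int s) + int s * int m))
           * gauss_binomial (q ^ s) n r
           * qS s h q m (int j) * qBell s h q r
           * (\<Prod>i<n - r. q_num q (int j * (1 - int s) + int s * int m + int s * int i))))"
  using qS_add_expanded[OF assms(2)] qBell_add[OF assms(2)]
  by (simp only: shift_coeff_def ac_simps) blast

end
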